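(* Let $G$ be a finite graph with an edge $uv$. Let $H$ be the graph obtained from $G$ by replacing the edge $uv$ with a length four path $u-x-y-z-v$; that is, the edge $uv$ is removed, three new vertices $x,y,z$ are added, and the edges $ux$, $xy$, $yz$, $zv$ are added. Then $I(H)$ and $\Sigma I(G)$ have the same simple homotopy type.
   Context: Graphs are finite and undirected; loops and multiple edges are allowed. An independent set of a graph is a set of vertices no two of which are joined by an edge (a vertex carrying a loop belongs to no independent set). The independence complex $I(G)$ is the simplicial complex whose simplices are the independent sets of $G$ (including the empty set $\emptyset$). For a simplicial complex $K$, $\Sigma K$ denotes the simplicial suspension of $K$, i.e. the join of $K$ with $\partial\Delta^1$ (two points). An elementary collapse of a simplicial complex removes a pair of simplices $\sigma\subsetneq\tau$, with $\sigma$ nonempty, $\dim\tau=\dim\sigma+1$, and $\tau$ the only simplex properly containing $\sigma$; an elementary expansion is the inverse operation. Two finite simplicial complexes have the same simple homotopy type if they are connected, up to simplicial isomorphism, by a finite sequence of elementary collapses and elementary expansions. *)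

theory Defs
  imports Main "HOL-Library.Multiset" "HOL-Library.Uprod"
begin

section \<open>Finite undirected graphs with loops and multiple edges\<close>

text \<open>
  Edges form a multiset of unordered pairs of endpoints: a loop at \<open>a\<close> is the pair
  \<open>Upair a a\<close>, and parallel edges are repeated elements.
\<close>

record 'a multigraph =
  verts :: "'a set"
  edges :: "'a uprod multiset"

definition finite_graph :: "'a multigraph \<Rightarrow> bool" where
  "finite_graph G \<longleftrightarrow> finite (verts G) \<and> (\<forall>e\<in>#edges G. set_uprod e \<subseteq> verts G)"

text \<open>The case \<open>a = b\<close> below excludes the vertices that carry a loop.\<close>

definition independent_set :: "'a multigraph \<Rightarrow> 'a set \<Rightarrow> bool" where
  "independent_set G A \<longleftrightarrow>
     A \<subseteq> verts G \<and> (\<forall>a\<in>A. \<forall>b\<in>A. Upair a b \<notin># edges G)"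

definition independence_complex :: "'a multigraph \<Rightarrow> 'a set set" where
  "independence_complex G = {A. independent_set G A}"

text \<open>
  The difference is one of multisets: a single copy of the edge \<open>uv\<close> is
  replaced, and edges parallel to it stay.
\<close>

definition replace_edge_by_path4 ::
    "'a multigraph \<Rightarrow> 'a \<Rightarrow> 'a \<Rightarrow> 'a \<Rightarrow> 'a \<Rightarrow> 'a \<Rightarrow> 'a multigraph" where
  "replace_edge_by_path4 G u v x y z =
     \<lparr>verts = verts G \<union> {x, y, z},
      edges = (edges G - {#Upair u v#}) + {#Upair u x, Upair x y, Upair y z, Upair z v#}\<rparr>"


section \<open>Finite simplicial complexes\<close>

text \<open>
  A complex is given by its set of simplices. The empty simplex always belongs to it,
  and the vertices of \<open>K\<close> are the elements of \<open>\<Union>K\<close>.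
\<close>

definition finite_complex :: "'a set set \<Rightarrow> bool" where
  "finite_complex K \<longleftrightarrow>
     finite K \<and> {} \<in> K \<and> (\<forall>\<sigma>\<in>K. finite \<sigma> \<and> (\<forall>\<rho>. \<rho> \<subseteq> \<sigma> \<longrightarrow> \<rho> \<in> K))"

definition complex_join :: "'a set set \<Rightarrow> 'b set set \<Rightarrow> ('a + 'b) set set" where
  "complex_join K L = {\<sigma> <+> \<tau> | \<sigma> \<tau>. \<sigma> \<in> K \<and> \<tau> \<in> L}"

definition boundary_simplex :: "'a set \<Rightarrow> 'a set set" where
  "boundary_simplex V = {\<sigma>. \<sigma> \<subset> V}"

text \<open>The type \<open>bool\<close> provides the two vertices of \<open>\<Delta>\<^sup>1\<close>.\<close>

definition suspension :: "'a set set \<Rightarrow> ('a + bool) set set" where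
  "suspension K = complex_join K (boundary_simplex (UNIV :: bool set))"

definition simplicial_iso :: "'a set set \<Rightarrow> 'b set set \<Rightarrow> bool" where
  "simplicial_iso K L \<longleftrightarrow> (\<exists>f. bij_betw f (\<Union>K) (\<Union>L) \<and> (\<lambda>\<sigma>. f ` \<sigma>) ` K = L)"

text \<open>
  \<open>elementary_collapse K L\<close>: the complex \<open>L\<close> arises from \<open>K\<close> by one elementary
  collapse. As a simplex has dimension one less than its number of vertices, the
  dimension condition is stated with cardinalities.
\<close>

definition elementary_collapse :: "'a set set \<Rightarrow> 'a set set \<Rightarrow> bool" where
  "elementary_collapse K L \<longleftrightarrow> finite_complex K \<and>
     (\<exists>\<sigma>\<in>K. \<exists>\<tau>\<in>K. \<sigma> \<noteq> {} \<and> \<sigma> \<subset> \<tau> \<and> card \<tau> = card \<sigma> + 1 \<and>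
        (\<forall>\<rho>\<in>K. \<sigma> \<subset> \<rho> \<longrightarrow> \<rho> = \<tau>) \<and> L = K - {\<sigma>, \<tau>})"

definition simple_homotopy_step :: "'a set set \<Rightarrow> 'a set set \<Rightarrow> bool" where
  "simple_homotopy_step K L \<longleftrightarrow>
     elementary_collapse K L \<or> elementary_collapse L K \<or> simplicial_iso K L"

text \<open>
  The two complexes may have vertices of different types, and expansions need an
  unlimited supply of new vertices. Therefore the sequence is formed after the complexes
  have been replaced by isomorphic ones with natural numbers as vertices.
\<close>

definition same_simple_homotopy_type :: "'a set set \<Rightarrow> 'b set set \<Rightarrow> bool" where
  "same_simple_homotopy_type K L \<longleftrightarrow> finite_complex K \<and> finite_complex L \<and>
     (\<exists>(K' :: nat set set) (L' :: nat set set).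
        simplicial_iso K K' \<and> simplicial_iso L L' \<and> simple_homotopy_step\<^sup>*\<^sup>* K' L')"


section \<open>Basic facts\<close>

lemma finite_complex_independence_complex:
  assumes "finite_graph G"
  shows "finite_complex (independence_complex G)"
proof -
  have fin: "finite (verts G)"
    using assms by (simp add: finite_graph_def)
  have "independence_complex G \<subseteq> Pow (verts G)"
    by (auto simp: independence_complex_def independent_set_def)
  then have "finite (independence_complex G)"
    using fin by (meson finite_Pow_iff finite_subset)
  then show ?thesis
    using fin unfolding finite_complex_def independence_complex_def independent_set_def
    by (auto intro: finite_subset)
qed

lemma finite_graph_replace_edge_by_path4:
  assumes "finite_graph G" "Upair u v \<in># edges G"
  shows "finite_graph (replace_edge_by_path4 G u v x y z)"
  using assms
  by (fastforce simp: finite_graph_def replace_edge_by_path4_def dest: in_diffD)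

lemma finite_complex_suspension:
  assumes "finite_complex K"
  shows "finite_complex (suspension K)"
proof -
  let ?B = "boundary_simplex (UNIV :: bool set)"
  have img: "suspension K = (\<lambda>(\<sigma>, \<tau>). \<sigma> <+> \<tau>) ` (K \<times> ?B)"
    by (auto simp: suspension_def complex_join_def)
  have "finite (suspension K)"
    unfolding img using assms by (auto simp: finite_complex_def)
  moreover have "{} \<in> suspension K"
    unfolding img using assms
    by (auto simp: finite_complex_def boundary_simplex_def intro!: image_eqI[where x = "({}, {})"])
  moreover have "finite \<rho>" if "\<rho> \<in> suspension K" for \<rho>
    using that assms by (auto simp: img finite_complex_def)
  moreover have "\<rho> \<in> suspension K" if mem: "\<omega> \<in> suspension K" and sub: "\<rho> \<subseteq> \<omega>" for \<rho> \<omega>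
  proof -
    obtain \<sigma> \<tau> where st: "\<sigma> \<in> K" "\<tau> \<subset> UNIV" "\<omega> = \<sigma> <+> (\<tau> :: bool set)"
      using mem by (auto simp: suspension_def complex_join_def boundary_simplex_def)
    have dec: "\<rho> = (Inl -` \<rho>) <+> (Inr -` \<rho>)"
      by (auto simp: Plus_def image_iff) (metis sum.exhaust)
    have "Inl -` \<rho> \<subseteq> \<sigma>" "Inr -` \<rho> \<subseteq> \<tau>"
      using sub st(3) by auto
    then have "Inl -` \<rho> \<in> K" "Inr -` \<rho> \<in> ?B"
      using st assms by (auto simp: finite_complex_def boundary_simplex_def)
    then show ?thesis
      unfolding suspension_def complex_join_def using dec by blast
  qed
  ultimately show ?thesis
    by (auto simp: finite_complex_def)
qed

end

theory Submission
  imports Defs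
begin

text \<open>
  Let \<open>K\<close> be the independence complex of \<open>G\<close> with one copy of the edge \<open>uv\<close> deleted, and let
  \<open>w\<close> be a new vertex. Both complexes are collapses of one complex \<open>P\<close>, whose simplices are the
  simplices of \<open>K\<close> enlarged by some of \<open>x, y, z, w\<close> and containing none of the sets \<open>ux\<close>, \<open>xy\<close>,
  \<open>yz\<close>, \<open>zv\<close>, \<open>yw\<close>, \<open>uvw\<close>. To reach \<open>I(H)\<close>, remove the simplices with \<open>w\<close>: pair off those that
  contain \<open>u\<close> by toggling \<open>z\<close>, then the others by toggling \<open>x\<close>. To reach \<open>\<Sigma>I(G)\<close> with suspension
  points \<open>y\<close> and \<open>w\<close>, remove the simplices that meet \<open>{x, z}\<close> by toggling \<open>w\<close>, and then those that
  contain \<open>u\<close> and \<open>v\<close> by toggling \<open>y\<close>.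
\<close>

section \<open>Collapses\<close>

abbreviation collapses :: "'a set set \<Rightarrow> 'a set set \<Rightarrow> bool" where
  "collapses \<equiv> elementary_collapse\<^sup>*\<^sup>*"

text \<open>The only simplex of \<open>K\<close> properly containing \<open>\<sigma>\<close> is
  \<open>\<tau>\<close>, which is removed too, so no remaining simplex has a removed face.\<close>

lemma elementary_collapse_finite_complex:
  assumes "elementary_collapse K L"
  shows "finite_complex L"
proof -
  obtain \<sigma> \<tau> where K: "finite_complex K" and st: "\<sigma> \<noteq> {}" "\<sigma> \<subset> \<tau>"
    and max: "\<And>\<rho>. \<rho> \<in> K \<Longrightarrow> \<sigma> \<subset> \<rho> \<Longrightarrow> \<rho> = \<tau>" and L: "L = K - {\<sigma>, \<tau>}"
    using assms unfolding elementary_collapse_def by blast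
  have "\<rho> \<in> L" if "\<omega> \<in> L" "\<rho> \<subseteq> \<omega>" for \<rho> \<omega>
  proof -
    have "\<omega> \<in> K" "\<omega> \<noteq> \<sigma>" "\<omega> \<noteq> \<tau>" using that L by auto
    moreover have "\<rho> \<in> K" using that K L by (auto simp: finite_complex_def)
    ultimately show ?thesis using max[of \<omega>] that st L by blast
  qed
  then show ?thesis
    using K st L unfolding finite_complex_def by blast
qed

text \<open>The pairs \<open>\<sigma>\<close>, \<open>insert p \<sigma>\<close> form a matching of
  \<open>R\<close>. Among the members of \<open>R\<close> without \<open>p\<close>, a maximal one is
  a free face: a simplex containing it lies in \<open>R\<close> by \<open>up\<close>, and deleting
  \<open>p\<close> from that simplex gives back the maximal one. Removing such pairs one after
  another exhausts \<open>R\<close>.\<close>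

lemma collapses_toggle:
  assumes "finite_complex K" "R \<subseteq> K" "{} \<notin> R"
    and up: "\<And>\<sigma> \<tau>. \<sigma> \<in> R \<Longrightarrow> \<tau> \<in> K \<Longrightarrow> \<sigma> \<subseteq> \<tau> \<Longrightarrow> \<tau> \<in> R"
    and ins: "\<And>\<sigma>. \<sigma> \<in> R \<Longrightarrow> insert p \<sigma> \<in> K"
    and del: "\<And>\<sigma>. \<sigma> \<in> R \<Longrightarrow> \<sigma> - {p} \<in> R"
  shows "collapses K (K - R)"
  using assms
proof (induction "card R" arbitrary: K R rule: less_induct)
  case less
  show ?case
  proof (cases "R = {}")
    case True
    then show ?thesis by simp
  next
    case False
    have finK: "finite K" using less.prems(1) by (simp add: finite_complex_def)
    then have finR: "finite R" using less.prems(2) finite_subset by blast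
    define D where "D = {\<sigma> \<in> R. p \<notin> \<sigma>}"
    have "finite D" "D \<noteq> {}" using finR False less.prems(6) unfolding D_def by auto
    then obtain \<sigma> where sD: "\<sigma> \<in> D" and max: "\<And>\<rho>. \<rho> \<in> D \<Longrightarrow> \<sigma> \<subseteq> \<rho> \<Longrightarrow> \<sigma> = \<rho>"
      using finite_has_maximal by metis
    then have sR: "\<sigma> \<in> R" and ps: "p \<notin> \<sigma>" by (auto simp: D_def)
    define \<tau> where "\<tau> = insert p \<sigma>"
    have tK: "\<tau> \<in> K" using less.prems(5) sR by (simp add: \<tau>_def)
    have tR: "\<tau> \<in> R" using less.prems(4)[OF sR tK] by (auto simp: \<tau>_def)
    have fins: "finite \<sigma>" using sR less.prems(1,2) by (auto simp: finite_complex_def)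
    have sup: "\<rho> = \<sigma> \<or> \<rho> = \<tau>" if "\<rho> \<in> K" "\<sigma> \<subseteq> \<rho>" for \<rho>
    proof -
      have "\<rho> \<in> R" using less.prems(4) sR that by blast
      then have "\<rho> - {p} \<in> D" using less.prems(6) by (simp add: D_def)
      then have "\<sigma> = \<rho> - {p}" using max that(2) ps by blast
      then show ?thesis by (auto simp: \<tau>_def)
    qed
    have ec: "elementary_collapse K (K - {\<sigma>, \<tau>})"
      unfolding elementary_collapse_def
    proof (intro conjI bexI)
      show "\<sigma> \<noteq> {}" using sR less.prems(3) by auto
      show "card \<tau> = card \<sigma> + 1" using fins ps by (simp add: \<tau>_def)
      show "\<forall>\<rho>\<in>K. \<sigma> \<subset> \<rho> \<longrightarrow> \<rho> = \<tau>" using sup by blast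
    qed (use less.prems(1,2) sR tK ps in \<open>auto simp: \<tau>_def\<close>)
    let ?K = "K - {\<sigma>, \<tau>}" and ?R = "R - {\<sigma>, \<tau>}"
    \<comment> \<open>Toggling \<open>p\<close> never leads from another simplex into the removed
      pair, so \<open>ins\<close> and \<open>del\<close> pass to the smaller complex.\<close>
    have pair: "\<rho> = \<sigma> \<or> \<rho> = \<tau>"
      if "insert p \<rho> = \<tau> \<or> insert p \<rho> = \<sigma> \<or> \<rho> - {p} = \<sigma> \<or> \<rho> - {p} = \<tau>" for \<rho>
      using that ps by (auto simp: \<tau>_def)
    have "collapses ?K (?K - ?R)"
    proof (rule less.hyps)
      show "card ?R < card R" using finR sR by (intro psubset_card_mono) auto
      show "finite_complex ?K" using elementary_collapse_finite_complex[OF ec] .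
      show "\<tau>' \<in> ?R" if "\<sigma>' \<in> ?R" "\<tau>' \<in> ?K" "\<sigma>' \<subseteq> \<tau>'" for \<sigma>' \<tau>'
        using that less.prems(4)[of \<sigma>' \<tau>'] by blast
      show "insert p \<rho> \<in> ?K" if "\<rho> \<in> ?R" for \<rho>
        using that less.prems(5)[of \<rho>] pair[of \<rho>] by blast
      show "\<rho> - {p} \<in> ?R" if "\<rho> \<in> ?R" for \<rho>
        using that less.prems(6)[of \<rho>] pair[of \<rho>] by blast
    qed (use less.prems(2,3) in auto)
    moreover have "?K - ?R = K - R" using sR tR by blast
    ultimately show ?thesis using ec by (metis converse_rtranclp_into_rtranclp)
  qed
qed

lemma collapses_finite_complex:
  "collapses K L \<Longrightarrow> finite_complex K \<Longrightarrow> finite_complex L"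
  by (induction rule: rtranclp_induct) (auto intro: elementary_collapse_finite_complex)

lemma collapses_subset: "collapses K L \<Longrightarrow> L \<subseteq> K"
  by (induction rule: rtranclp_induct) (auto simp: elementary_collapse_def)

lemma collapses_simple_homotopy:
  assumes "collapses K L"
  shows "simple_homotopy_step\<^sup>*\<^sup>* K L" "simple_homotopy_step\<^sup>*\<^sup>* L K"
  using assms
  by (induction rule: rtranclp_induct)
    (auto simp: simple_homotopy_step_def
      intro: rtranclp.rtrancl_into_rtrancl converse_rtranclp_into_rtranclp)

section \<open>Transport along injective vertex maps\<close>

lemma finite_complex_image:
  assumes "finite_complex K"
  shows "finite_complex ((`) f ` K)"
proof -
  have "\<rho> \<in> (`) f ` K" if "\<sigma> \<in> K" "\<rho> \<subseteq> f ` \<sigma>" for \<sigma> \<rho>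
    using that assms unfolding finite_complex_def by (metis image_eqI subset_imageE)
  then show ?thesis
    using assms by (auto simp: finite_complex_def)
qed

text \<open>Injectivity on the vertices makes images reflect inclusion and keep cardinalities, so a
  free pair goes to a free pair.\<close>

lemma elementary_collapse_image:
  assumes "elementary_collapse K L" and inj: "inj_on f (\<Union>K)"
  shows "elementary_collapse ((`) f ` K) ((`) f ` L)"
proof -
  obtain \<sigma> \<tau> where K: "finite_complex K" and st: "\<sigma> \<in> K" "\<tau> \<in> K" "\<sigma> \<noteq> {}" "\<sigma> \<subset> \<tau>"
    and c: "card \<tau> = card \<sigma> + 1"
    and max: "\<And>\<rho>. \<rho> \<in> K \<Longrightarrow> \<sigma> \<subset> \<rho> \<Longrightarrow> \<rho> = \<tau>" and L: "L = K - {\<sigma>, \<tau>}"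
    using assms(1) unfolding elementary_collapse_def by metis
  have inj2: "inj_on ((`) f) K"
    using inj by (rule inj_on_image)
  have sub: "f ` \<alpha> \<subseteq> f ` \<beta> \<longleftrightarrow> \<alpha> \<subseteq> \<beta>" if "\<alpha> \<in> K" "\<beta> \<in> K" for \<alpha> \<beta>
  proof
    assume *: "f ` \<alpha> \<subseteq> f ` \<beta>"
    show "\<alpha> \<subseteq> \<beta>"
    proof
      fix a
      assume "a \<in> \<alpha>"
      with * obtain c where "c \<in> \<beta>" "f a = f c" by blast
      moreover from this have "a = c"
        by (intro inj_onD[OF inj]) (use \<open>a \<in> \<alpha>\<close> that in auto)
      ultimately show "a \<in> \<beta>" by simp
    qed
  qed (rule image_mono)
  have psub: "f ` \<alpha> \<subset> f ` \<beta> \<longleftrightarrow> \<alpha> \<subset> \<beta>" if "\<alpha> \<in> K" "\<beta> \<in> K" for \<alpha> \<beta>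
    unfolding less_le_not_le by (simp only: sub that)
  have card: "card (f ` \<alpha>) = card \<alpha>" if "\<alpha> \<in> K" for \<alpha>
    by (rule card_image, rule inj_on_subset[OF inj]) (use that in auto)
  have "(`) f ` L = (`) f ` K - {f ` \<sigma>, f ` \<tau>}"
    using inj_on_image_set_diff[OF inj2, of K "{\<sigma>, \<tau>}"] st L by auto
  then show ?thesis
    unfolding elementary_collapse_def
  proof (intro conjI bexI)
    show "f ` \<sigma> \<subset> f ` \<tau>" using psub st by simp
    show "card (f ` \<tau>) = card (f ` \<sigma>) + 1" using card st c by simp
    show "\<forall>\<rho>\<in>(`) f ` K. f ` \<sigma> \<subset> \<rho> \<longrightarrow> \<rho> = f ` \<tau>"
      using psub[OF \<open>\<sigma> \<in> K\<close>] max by (simp add: ball_simps)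
  qed (use finite_complex_image[OF K] st in simp_all)
qed

lemma collapses_image:
  assumes "collapses K L" and "inj_on f (\<Union>K)"
  shows "collapses ((`) f ` K) ((`) f ` L)"
  using assms
proof (induction rule: rtranclp_induct)
  case (step L M)
  then have "inj_on f (\<Union>L)"
    using inj_on_subset[OF step.prems Union_mono[OF collapses_subset[OF step.hyps(1)]]] by blast
  then have "elementary_collapse ((`) f ` L) ((`) f ` M)"
    by (rule elementary_collapse_image[OF step.hyps(2)])
  with step.IH[OF step.prems] show ?case by (rule rtranclp.rtrancl_into_rtrancl)
qed simp

lemma simplicial_iso_image: "inj_on f (\<Union>K) \<Longrightarrow> simplicial_iso K ((`) f ` K)"
  unfolding simplicial_iso_def by (intro exI[of _ f]) (auto simp: bij_betw_def)

lemma simplicial_iso_trans: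
  assumes "simplicial_iso K L" "simplicial_iso L M"
  shows "simplicial_iso K M"
proof -
  obtain f g where "bij_betw f (\<Union>K) (\<Union>L)" "(`) f ` K = L"
    "bij_betw g (\<Union>L) (\<Union>M)" "(`) g ` L = M"
    using assms unfolding simplicial_iso_def by blast
  then show ?thesis
    unfolding simplicial_iso_def
    by (intro exI[of _ "g \<circ> f"]) (auto simp: image_comp intro: bij_betw_trans)
qed

text \<open>A single labelling \<open>f\<close> of the vertices of \<open>P\<close> by natural
  numbers restricts to \<open>M\<close> and to \<open>N\<close>. The relabelled copies are then
  joined by expanding from \<open>M\<close> up to \<open>P\<close> and collapsing down to
  \<open>N\<close>.\<close>

lemma same_simple_homotopy_type_if_common_expansion:
  assumes P: "finite_complex P" and M: "collapses P M" and N: "collapses P N"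
    and KM: "simplicial_iso K M" and LN: "simplicial_iso L N"
    and fin: "finite_complex K" "finite_complex L"
  shows "same_simple_homotopy_type K L"
proof -
  have "finite (\<Union>P)" using P by (auto simp: finite_complex_def)
  then obtain f :: "_ \<Rightarrow> nat" where f: "inj_on f (\<Union>P)"
    using finite_imp_inj_to_nat_seg by metis
  have iso: "simplicial_iso B ((`) f ` B)" if "collapses P B" for B
  proof (rule simplicial_iso_image)
    have "\<Union>B \<subseteq> \<Union>P" using collapses_subset[OF that] by (rule Union_mono)
    with f show "inj_on f (\<Union>B)" by (rule inj_on_subset)
  qed
  have "simple_homotopy_step\<^sup>*\<^sup>* ((`) f ` M) ((`) f ` N)"
    using collapses_simple_homotopy(2)[OF collapses_image[OF M f]]
      collapses_simple_homotopy(1)[OF collapses_image[OF N f]] by (rule rtranclp_trans)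
  with simplicial_iso_trans[OF KM iso[OF M]] simplicial_iso_trans[OF LN iso[OF N]]
  have "\<exists>(K' :: nat set set) (L' :: nat set set).
      simplicial_iso K K' \<and> simplicial_iso L L' \<and> simple_homotopy_step\<^sup>*\<^sup>* K' L'"
    by metis
  with fin show ?thesis
    by (simp only: same_simple_homotopy_type_def simp_thms)
qed

section \<open>The common expansion\<close>

text \<open>The last condition is what brings in \<open>I(G)\<close>: beside \<open>w\<close>, the
  part of a simplex lying in \<open>K\<close> must not contain both \<open>u\<close> and
  \<open>v\<close>. The case \<open>u = v\<close> is allowed, which covers a loop.\<close>

definition expansion :: "'a set set \<Rightarrow> 'a \<Rightarrow> 'a \<Rightarrow> 'a \<Rightarrow> 'a \<Rightarrow> 'a \<Rightarrow> 'a \<Rightarrow> 'a set set" where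
  "expansion K u v x y z w =
     {\<sigma>. \<sigma> - {x, y, z, w} \<in> K \<and> \<not> {u, x} \<subseteq> \<sigma> \<and> \<not> {x, y} \<subseteq> \<sigma> \<and> \<not> {y, z} \<subseteq> \<sigma> \<and>
        \<not> {z, v} \<subseteq> \<sigma> \<and> \<not> {y, w} \<subseteq> \<sigma> \<and> \<not> {u, v, w} \<subseteq> \<sigma>}"

lemma finite_complex_expansion:
  assumes "finite_complex K"
  shows "finite_complex (expansion K u v x y z w)"
proof -
  have fin: "finite (\<Union>K \<union> {x, y, z, w})" using assms by (auto simp: finite_complex_def)
  have sub: "expansion K u v x y z w \<subseteq> Pow (\<Union>K \<union> {x, y, z, w})"
    by (auto simp: expansion_def)
  have "\<rho> \<in> expansion K u v x y z w" if "\<sigma> \<in> expansion K u v x y z w" "\<rho> \<subseteq> \<sigma>" for \<sigma> \<rho>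
  proof -
    have "\<rho> - {x, y, z, w} \<subseteq> \<sigma> - {x, y, z, w}" using that(2) by blast
    then have "\<rho> - {x, y, z, w} \<in> K"
      using that(1) assms unfolding expansion_def finite_complex_def by blast
    then show ?thesis using that unfolding expansion_def by blast
  qed
  moreover have "{} \<in> expansion K u v x y z w"
    using assms by (auto simp: expansion_def finite_complex_def)
  ultimately show ?thesis
    unfolding finite_complex_def using fin sub
    by (meson PowD finite_Pow_iff finite_subset subsetD)
qed

context
  fixes K :: "'a set set" and u v x y z w :: 'a
  assumes K: "finite_complex K"
    and uv: "u \<notin> {x, y, z, w}" "v \<notin> {x, y, z, w}"
    and dist: "distinct [x, y, z, w]"
begin

text \<open>A simplex with \<open>w\<close> lacks \<open>y\<close>. If it contains \<open>u\<close>,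
  it also lacks \<open>v\<close>, so nothing in it conflicts with \<open>z\<close>. Once these are
  gone, a simplex with \<open>w\<close> lacks both \<open>u\<close> and \<open>y\<close>, so nothing
  in it conflicts with \<open>x\<close>.\<close>

lemma collapses_expansion_to_path:
  "collapses (expansion K u v x y z w) {\<sigma> \<in> expansion K u v x y z w. w \<notin> \<sigma>}"
proof -
  let ?P = "expansion K u v x y z w"
  let ?R = "{\<sigma> \<in> ?P. w \<in> \<sigma> \<and> u \<in> \<sigma>}"
  let ?S = "{\<sigma> \<in> ?P - ?R. w \<in> \<sigma>}"
  \<comment> \<open>Keeping the part in \<open>K\<close> opaque reduces each check to membership of
    single vertices, since toggling a new vertex does not change \<open>b\<close>.\<close>
  define b where "b \<sigma> = \<sigma> - {x, y, z, w}" for \<sigma>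
  have b: "b (insert p \<sigma>) = b \<sigma>" "b (\<sigma> - {p}) = b \<sigma>" if "p \<in> {x, y, z, w}" for p \<sigma>
    using that by (auto simp: b_def)
  note P_iff = expansion_def[of K u v x y z w, folded b_def]
  have R: "collapses ?P (?P - ?R)"
  proof (rule collapses_toggle[where p = z])
    show "insert z \<sigma> \<in> ?P" "\<sigma> - {z} \<in> ?R" if "\<sigma> \<in> ?R" for \<sigma>
      using that uv dist by (auto simp: P_iff b)
  qed (use finite_complex_expansion[OF K] in auto)
  have "collapses (?P - ?R) (?P - ?R - ?S)"
  proof (rule collapses_toggle[where p = x])
    show "insert x \<sigma> \<in> ?P - ?R" "\<sigma> - {x} \<in> ?S" if "\<sigma> \<in> ?S" for \<sigma>
      using that uv dist by (auto simp: P_iff b)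
  qed (use collapses_finite_complex[OF R finite_complex_expansion[OF K]] in auto)
  moreover have "?P - ?R - ?S = {\<sigma> \<in> ?P. w \<notin> \<sigma>}" by blast
  ultimately show ?thesis using R by (metis (no_types, lifting) rtranclp_trans)
qed

text \<open>A simplex with \<open>x\<close> or \<open>z\<close> lacks \<open>y\<close>; it also
  lacks \<open>u\<close> in the first case and \<open>v\<close> in the second. So \<open>w\<close>
  completes neither \<open>yw\<close> nor \<open>uvw\<close>. Afterwards \<open>x\<close> and
  \<open>z\<close> are absent, and a simplex with \<open>u\<close> and \<open>v\<close> lacks
  \<open>w\<close>, so nothing in it conflicts with \<open>y\<close>.\<close>

lemma collapses_expansion_to_suspension:
  "collapses (expansion K u v x y z w)
     {\<sigma> \<in> expansion K u v x y z w. x \<notin> \<sigma> \<and> z \<notin> \<sigma> \<and> \<not> {u, v} \<subseteq> \<sigma>}"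
proof -
  let ?P = "expansion K u v x y z w"
  let ?R = "{\<sigma> \<in> ?P. x \<in> \<sigma> \<or> z \<in> \<sigma>}"
  let ?S = "{\<sigma> \<in> ?P - ?R. u \<in> \<sigma> \<and> v \<in> \<sigma>}"
  define b where "b \<sigma> = \<sigma> - {x, y, z, w}" for \<sigma>
  have b: "b (insert p \<sigma>) = b \<sigma>" "b (\<sigma> - {p}) = b \<sigma>" if "p \<in> {x, y, z, w}" for p \<sigma>
    using that by (auto simp: b_def)
  note P_iff = expansion_def[of K u v x y z w, folded b_def]
  have R: "collapses ?P (?P - ?R)"
  proof (rule collapses_toggle[where p = w])
    show "insert w \<sigma> \<in> ?P" "\<sigma> - {w} \<in> ?R" if "\<sigma> \<in> ?R" for \<sigma>
      using that uv dist by (auto simp: P_iff b)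
  qed (use finite_complex_expansion[OF K] in auto)
  have "collapses (?P - ?R) (?P - ?R - ?S)"
  proof (rule collapses_toggle[where p = y])
    show "insert y \<sigma> \<in> ?P - ?R" "\<sigma> - {y} \<in> ?S" if "\<sigma> \<in> ?S" for \<sigma>
      using that uv dist by (auto simp: P_iff b)
  qed (use collapses_finite_complex[OF R finite_complex_expansion[OF K]] in auto)
  moreover have "?P - ?R - ?S = {\<sigma> \<in> ?P. x \<notin> \<sigma> \<and> z \<notin> \<sigma> \<and> \<not> {u, v} \<subseteq> \<sigma>}" by blast
  ultimately show ?thesis using R by (metis (no_types, lifting) rtranclp_trans)
qed

end

section \<open>Independence complexes\<close>

lemma independence_complex_edge:
  assumes "Upair u v \<in># edges G"
  shows "independence_complex G =
    {A \<in> independence_complex (G\<lparr>edges := edges G - {#Upair u v#}\<rparr>). \<not> {u, v} \<subseteq> A}"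
proof -
  \<comment> \<open>Both alternatives hold when a parallel copy of the edge survives the
    deletion.\<close>
  have "e \<in># edges G \<longleftrightarrow> e \<in># edges G - {#Upair u v#} \<or> e = Upair u v" for e
    using assms by (metis in_diffD insert_DiffM insert_noteq_member)
  then show ?thesis
    by (auto simp: independence_complex_def independent_set_def)
qed

lemma independence_complex_replace_edge_by_path4:
  assumes "finite_graph G"
    and new: "x \<notin> verts G" "y \<notin> verts G" "z \<notin> verts G"
  shows "independence_complex (replace_edge_by_path4 G u v x y z) =
    {A. A - {x, y, z} \<in> independence_complex (G\<lparr>edges := edges G - {#Upair u v#}\<rparr>) \<and>
        \<not> {u, x} \<subseteq> A \<and> \<not> {x, y} \<subseteq> A \<and> \<not> {y, z} \<subseteq> A \<and> \<not> {z, v} \<subseteq> A}"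
proof -
  let ?E = "edges G - {#Upair u v#}"
  \<comment> \<open>Old edges do not touch the new vertices, so they only need to be tested on
    \<open>A - {x, y, z}\<close>.\<close>
  have ends: "a \<in> verts G \<and> b \<in> verts G" if "Upair a b \<in># ?E" for a b
    using in_diffD[OF that] assms(1) by (force simp: finite_graph_def)
  have edge: "Upair a b \<in># edges (replace_edge_by_path4 G u v x y z) \<longleftrightarrow>
      Upair a b \<in># ?E \<or> {a, b} = {u, x} \<or> {a, b} = {x, y} \<or> {a, b} = {y, z} \<or> {a, b} = {z, v}" for a b
    by (auto simp: replace_edge_by_path4_def doubleton_eq_iff simp del: in_diff_count)
  have "(\<forall>a\<in>A. \<forall>b\<in>A. Upair a b \<notin># edges (replace_edge_by_path4 G u v x y z)) \<longleftrightarrow>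
      (\<forall>a\<in>A. \<forall>b\<in>A. Upair a b \<notin># ?E) \<and>
        \<not> {u, x} \<subseteq> A \<and> \<not> {x, y} \<subseteq> A \<and> \<not> {y, z} \<subseteq> A \<and> \<not> {z, v} \<subseteq> A" for A
    unfolding edge doubleton_eq_iff by blast
  moreover have "(\<forall>a\<in>A. \<forall>b\<in>A. Upair a b \<notin># ?E) \<longleftrightarrow>
      (\<forall>a\<in>A - {x, y, z}. \<forall>b\<in>A - {x, y, z}. Upair a b \<notin># ?E)" for A
    using ends new by blast
  moreover have "A \<subseteq> verts (replace_edge_by_path4 G u v x y z) \<longleftrightarrow> A - {x, y, z} \<subseteq> verts G" for A
    by (auto simp: replace_edge_by_path4_def)
  ultimately show ?thesis
    by (simp add: independence_complex_def independent_set_def)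
qed

text \<open>A set in a sum type is the disjoint sum of its two preimages, and a set of suspension
  points is a proper subset of \<open>UNIV\<close> exactly if it misses one of the two.\<close>

lemma mem_suspension_iff:
  "\<sigma> \<in> suspension K \<longleftrightarrow> Inl -` \<sigma> \<in> K \<and> \<not> {Inr True, Inr False} \<subseteq> \<sigma>"
proof
  assume "\<sigma> \<in> suspension K"
  then obtain A B where "A \<in> K" "B \<subset> (UNIV :: bool set)" "\<sigma> = A <+> B"
    by (auto simp: suspension_def complex_join_def boundary_simplex_def)
  moreover from this have "Inl -` \<sigma> = A" by auto
  ultimately show "Inl -` \<sigma> \<in> K \<and> \<not> {Inr True, Inr False} \<subseteq> \<sigma>"
    by (auto simp: UNIV_bool)
next
  assume *: "Inl -` \<sigma> \<in> K \<and> \<not> {Inr True, Inr False} \<subseteq> \<sigma>"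
  have "\<sigma> = (Inl -` \<sigma>) <+> (Inr -` \<sigma>)"
    by (auto simp: Plus_def image_iff) (metis sum.exhaust)
  moreover have "Inr -` \<sigma> \<subset> (UNIV :: bool set)"
    using * by auto
  ultimately show "\<sigma> \<in> suspension K"
    using * unfolding suspension_def complex_join_def boundary_simplex_def by blast
qed

lemma mem_image_Inl_iff: "\<sigma> \<in> (`) Inl ` K \<longleftrightarrow> Inl -` \<sigma> \<in> K \<and> (\<forall>b. Inr b \<notin> \<sigma>)"
proof
  assume *: "Inl -` \<sigma> \<in> K \<and> (\<forall>b. Inr b \<notin> \<sigma>)"
  then have "\<sigma> = Inl ` (Inl -` \<sigma>)"
    by (auto simp: image_iff) (metis sum.exhaust)
  with * show "\<sigma> \<in> (`) Inl ` K" by blast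
qed (auto simp: inj_vimage_image_eq)

theorem theorem1p1:
  fixes G :: "'a multigraph" and u v x y z :: 'a
  assumes "finite_graph G"
    and "Upair u v \<in># edges G"
    and "x \<notin> verts G" "y \<notin> verts G" "z \<notin> verts G"
    and "distinct [x, y, z]"
  shows "same_simple_homotopy_type
           (independence_complex (replace_edge_by_path4 G u v x y z))
           (suspension (independence_complex G))"
proof -
  let ?H = "replace_edge_by_path4 G u v x y z"
  define K where "K = independence_complex (G\<lparr>edges := edges G - {#Upair u v#}\<rparr>)"
  \<comment> \<open>Working in \<open>'a + bool\<close> supplies the new vertex \<open>w\<close> as
    \<open>Inr False\<close>, even if \<open>'a\<close> has no spare element. Taking
    \<open>Inr True\<close> for \<open>y\<close> makes the two suspension points those of
    \<open>suspension\<close>.\<close>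
  define P where
    "P = expansion ((`) Inl ` K) (Inl u) (Inl v) (Inl x) (Inr True) (Inl z) (Inr False)"
  \<comment> \<open>This choice of \<open>y\<close> leaves \<open>I(H)\<close> to be relabelled,
    which \<open>g\<close> does.\<close>
  define g where "g a = (if a = y then Inr True else Inl a)" for a :: 'a
  let ?M = "{\<sigma> \<in> P. Inr False \<notin> \<sigma>}"
  let ?N = "{\<sigma> \<in> P. Inl x \<notin> \<sigma> \<and> Inl z \<notin> \<sigma> \<and> \<not> {Inl u, Inl v} \<subseteq> \<sigma>}"
  have uv: "u \<in> verts G" "v \<in> verts G"
    using assms(1,2) by (force simp: finite_graph_def)+
  have "finite_graph (G\<lparr>edges := edges G - {#Upair u v#}\<rparr>)"
    using assms(1) by (auto simp: finite_graph_def dest: in_diffD)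
  then have finK: "finite_complex ((`) Inl ` K)"
    unfolding K_def by (intro finite_complex_image finite_complex_independence_complex)
  have Kverts: "\<Union>K \<subseteq> verts G"
    by (auto simp: K_def independence_complex_def independent_set_def)
  \<comment> \<open>The preimage under \<open>Inl\<close> already discards \<open>y\<close> and
    \<open>w\<close>, so only \<open>x\<close> and \<open>z\<close> remain to be subtracted.\<close>
  have P_iff: "\<sigma> \<in> P \<longleftrightarrow> Inl -` \<sigma> - {x, z} \<in> K \<and>
      \<not> {Inl u, Inl x} \<subseteq> \<sigma> \<and> \<not> {Inl x, Inr True} \<subseteq> \<sigma> \<and> \<not> {Inr True, Inl z} \<subseteq> \<sigma> \<and>
      \<not> {Inl z, Inl v} \<subseteq> \<sigma> \<and> \<not> {Inr True, Inr False} \<subseteq> \<sigma> \<and>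
      \<not> {Inl u, Inl v, Inr False} \<subseteq> \<sigma>" for \<sigma>
  proof -
    have "Inl -` (\<sigma> - {Inl x, Inr True, Inl z, Inr False}) = Inl -` \<sigma> - {x, z}" by auto
    moreover have "\<forall>b. Inr b \<notin> \<sigma> - {Inl x, Inr True, Inl z, Inr False}"
      by (metis (full_types) Diff_iff insertCI)
    ultimately show ?thesis
      unfolding P_def expansion_def mem_image_Inl_iff by simp
  qed
  have "finite_complex P" unfolding P_def by (rule finite_complex_expansion[OF finK])
  moreover have "collapses P ?M"
    unfolding P_def by (rule collapses_expansion_to_path[OF finK]) (use assms uv in auto)
  moreover have "collapses P ?N"
    unfolding P_def by (rule collapses_expansion_to_suspension[OF finK]) (use assms uv in auto)
  moreover have "simplicial_iso (independence_complex ?H) ?M"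
  proof -
    have H: "A \<in> independence_complex ?H \<longleftrightarrow> A - {x, y, z} \<in> K \<and> \<not> {u, x} \<subseteq> A \<and>
        \<not> {x, y} \<subseteq> A \<and> \<not> {y, z} \<subseteq> A \<and> \<not> {z, v} \<subseteq> A" for A
      using independence_complex_replace_edge_by_path4[OF assms(1,3-5)]
      by (simp add: K_def)
    have mem: "Inl a \<in> g ` A \<longleftrightarrow> a \<in> A \<and> a \<noteq> y" "Inr True \<in> g ` A \<longleftrightarrow> y \<in> A"
      "Inr False \<notin> g ` A" for a A
      by (auto simp: g_def image_iff)
    have "Inl -` (g ` A) - {x, z} = A - {x, y, z}" for A
      by (rule set_eqI) (auto simp only: vimage_eq mem Diff_iff insert_iff empty_iff)
    then have HM: "g ` A \<in> ?M \<longleftrightarrow> A \<in> independence_complex ?H" for A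
      using uv assms(3-6) by (auto simp: P_iff H mem)
    have surj: "\<exists>A. \<sigma> = g ` A" if "\<sigma> \<in> ?M" for \<sigma>
    proof -
      \<comment> \<open>Besides \<open>Inr False\<close>, this is the only point outside the range
        of \<open>g\<close>. It cannot occur, because \<open>y\<close> is neither a vertex of
        \<open>G\<close> nor equal to \<open>x\<close> or \<open>z\<close>.\<close>
      have "Inl y \<notin> \<sigma>"
        using that Kverts assms(4,6) by (auto simp: P_iff)
      have "s \<in> range g" if "s \<in> \<sigma>" for s
      proof (cases s)
        case (Inl a)
        then have "s = g a" using that \<open>Inl y \<notin> \<sigma>\<close> by (auto simp: g_def)
        then show ?thesis by simp
      next
        case (Inr b)
        then have b using that \<open>\<sigma> \<in> ?M\<close> by (cases b) simp_all
        then have "s = g y" using Inr by (simp add: g_def)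
        then show ?thesis by simp
      qed
      then have "\<sigma> \<subseteq> range g" by blast
      then show ?thesis by (auto simp: subset_image_iff)
    qed
    have "(`) g ` independence_complex ?H = ?M"
    proof (rule set_eqI, rule iffI)
      fix \<sigma>
      assume \<sigma>: "\<sigma> \<in> ?M"
      then obtain A where A: "\<sigma> = g ` A" using surj by metis
      have "A \<in> independence_complex ?H" using HM[of A] \<sigma> unfolding A by (rule iffD1)
      then show "\<sigma> \<in> (`) g ` independence_complex ?H" unfolding A by (rule imageI)
    qed (elim imageE, simp only: HM)
    moreover have "inj_on g (\<Union>(independence_complex ?H))"
      by (auto simp: inj_on_def g_def)
    ultimately show ?thesis using simplicial_iso_image[of g "independence_complex ?H"] by simp
  qed
  moreover have "simplicial_iso (suspension (independence_complex G)) ?N"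
  proof -
    have G: "A \<in> independence_complex G \<longleftrightarrow> A \<in> K \<and> \<not> {u, v} \<subseteq> A" for A
      using independence_complex_edge[OF assms(2)] by (auto simp: K_def)
    have "\<sigma> \<in> suspension (independence_complex G) \<longleftrightarrow> \<sigma> \<in> ?N" for \<sigma>
    proof -
      have x: "x \<notin> Inl -` \<sigma> \<and> z \<notin> Inl -` \<sigma>" if "Inl -` \<sigma> \<in> K"
        using that Kverts assms(3,5) by blast
      show ?thesis
      proof (cases "x \<in> Inl -` \<sigma> \<or> z \<in> Inl -` \<sigma>")
        case True
        then show ?thesis using x by (auto simp: mem_suspension_iff G)
      next
        case False
        \<comment> \<open>Without \<open>x\<close> and \<open>z\<close> their conditions are
          vacuous, and excluding \<open>uv\<close> subsumes \<open>uvw\<close>. What remains of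
          \<open>P_iff\<close> is membership in \<open>K\<close> and the exclusion of the pair of
          suspension points.\<close>
        then have "Inl -` \<sigma> - {x, z} = Inl -` \<sigma>" by blast
        with False show ?thesis by (auto simp: mem_suspension_iff G P_iff)
      qed
    qed
    \<comment> \<open>The two complexes are equal, so the identity serves as the
      isomorphism.\<close>
    then have "?N = suspension (independence_complex G)" by (intro set_eqI) simp
    then show ?thesis
      using simplicial_iso_image[of id ?N] by simp
  qed
  ultimately show ?thesis
    using finite_complex_independence_complex[OF finite_graph_replace_edge_by_path4[OF assms(1,2)]]
      finite_complex_suspension[OF finite_complex_independence_complex[OF assms(1)]]
    by (rule same_simple_homotopy_type_if_common_expansion)
qed

end
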